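(* For all $\mu_0,\mu_1\in\mathcal P_2(\mathbb R^d)$, $$\bar d_{\rm geom}^2(\mu_0,\mu_1)\le\bar d^2(\mu_0,\mu_1).$$ Conversely, equality holds provided that every admissible curve $\mu\in C([0,1];\mathcal P_2(\mathbb R^d))$ with finite geometric action admits, for every $\varepsilon>0$, jointly measurable fields $W:(0,1)\times\mathbb R^d\to\mathbb R^d$ and $r_t(x)=E_tx+C_t$ with $E\in L^2((0,1);\mathfrak{so}(d))$, $C\in L^2((0,1);\mathbb R^d)$, such that $-\nabla\cdot(\mu_tW_t)=\partial_t\mu_t$ for almost every $t$ and $$\int_0^1\int_{\mathbb R^d}|W_t-r_t|^2\,d\mu_t\,dt\le\int_0^1\|\partial_t\mu_t\|_{\mathrm{MBB},\mu_t}^2\,dt+\varepsilon .$$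
   Context: $\mathcal P_2(\mathbb R^d)$: Borel probability measures on $\mathbb R^d$ with finite second moment, with the metric $W_2$; $\mathfrak{so}(d)$: real skew-symmetric $d\times d$ matrices. For $\mu\in C([0,1];\mathcal P_2(\mathbb R^d))$, $L^2_\mu((0,1)\times\mathbb R^d;\mathbb R^d)$ denotes fields square integrable with respect to $d\mu_t\,dt$; for a single measure $\mu$, $L^2_\mu(\mathbb R^d)$ denotes $\mathbb R^d$-valued $\mu$-square-integrable fields. Dynamic value: $\bar d^2(\mu_0,\mu_1):=\inf\int_0^1\int|V_t|^2d\mu_t\,dt$ over all $(\mu,V,E,C)$ with $\mu\in C([0,1];\mathcal P_2(\mathbb R^d))$, $V\in L^2_\mu((0,1)\times\mathbb R^d;\mathbb R^d)$, $E\in L^2((0,1);\mathfrak{so}(d))$, $C\in L^2((0,1);\mathbb R^d)$, $\mu_{t=0}=\mu_0$, $\mu_{t=1}=\mu_1$ and $\partial_t\mu+\nabla\cdot(\mu(V+Ex+C))=0$ in $\mathcal D'((0,1)\times\mathbb R^d)$. Rigid fields: $\mathcal R_\mu:=\{r\in L^2_\mu(\mathbb R^d):\exists(E,C)\in\mathfrak{so}(d)\times\mathbb R^d,\ r(x)=Ex+C\ \mu\text{-a.e.}\}$. For $\mu\in\mathcal P_2(\mathbb R^d)$ let $\|\xi\|_{-1,\mu}:=\sup\{\langle\xi,\varphi\rangle:\varphi\in C_c^\infty(\mathbb R^d),\int|\nabla\varphi|^2d\mu\le1\}$ and let $T_\mu\mathcal P_2(\mathbb R^d)$ be the closure of $\{-\nabla\cdot(\mu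 V):V\in C_c^\infty(\mathbb R^d;\mathbb R^d)\}$ in $\|\cdot\|_{-1,\mu}$. The MBB seminorm of $\xi\in T_\mu\mathcal P_2(\mathbb R^d)$ is $$\|\xi\|_{\mathrm{MBB},\mu}^2:=\inf\Big\{\int|V-r|^2d\mu:\ V\in L^2_\mu(\mathbb R^d),\ r\in\mathcal R_\mu,\ -\nabla\cdot(\mu V)=\xi\text{ in }\mathcal D'(\mathbb R^d)\Big\}.$$ A pair $(\mu,\widetilde V)$ is admissible (and then $\mu$ is an admissible curve) if $\mu\in C([0,1];\mathcal P_2(\mathbb R^d))$, $\mu_{t=0}=\mu_0$, $\mu_{t=1}=\mu_1$, $\widetilde V\in L^2_\mu((0,1)\times\mathbb R^d;\mathbb R^d)$ and $\partial_t\mu+\nabla\cdot(\mu\widetilde V)=0$ in $\mathcal D'((0,1)\times\mathbb R^d)$; then for a.e. $t$, $\partial_t\mu_t:=-\nabla\cdot(\mu_t\widetilde V_t)\in T_{\mu_t}\mathcal P_2(\mathbb R^d)$. The geometric action is $\int_0^1\|\partial_t\mu_t\|^2_{\mathrm{MBB},\mu_t}dt$ and $\bar d_{\rm geom}^2(\mu_0,\mu_1)$ is its infimum over admissible pairs. *)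

theory Defs
  imports "HOL-Probability.Probability"
begin

subsection \<open>Smooth test functions\<close>

(* In finite dimension, C^(k+1) is equivalent to: differentiable everywhere, with all
   directional derivatives of class C^k. *)
primrec C_k :: "nat \<Rightarrow> ('a::euclidean_space \<Rightarrow> 'b::real_normed_vector) \<Rightarrow> bool" where
  "C_k 0 f \<longleftrightarrow> continuous_on UNIV f"
| "C_k (Suc k) f \<longleftrightarrow> (\<forall>x. f differentiable (at x)) \<and>
      (\<forall>v. C_k k (\<lambda>x. frechet_derivative f (at x) v))"

definition smooth :: "('a::euclidean_space \<Rightarrow> 'b::real_normed_vector) \<Rightarrow> bool" where
  "smooth f \<longleftrightarrow> (\<forall>k. C_k k f)"

(* C_c^infinity(S) for open S; the functions are extended by zero to the whole space. *)
definition test_functions :: "'a::euclidean_space set \<Rightarrow> ('a \<Rightarrow> real) set" where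
  "test_functions S =
     {\<phi>. smooth \<phi> \<and> compact (closure {x. \<phi> x \<noteq> 0}) \<and> closure {x. \<phi> x \<noteq> 0} \<subseteq> S}"

definition grad :: "('a::real_inner \<Rightarrow> real) \<Rightarrow> 'a \<Rightarrow> 'a" where
  "grad f x = (THE D. GDERIV f x :> D)"


subsection \<open>The space of probability measures with finite second moment\<close>

definition P2 :: "(real^'n) measure set" where
  "P2 = {\<mu>. prob_space \<mu> \<and> sets \<mu> = sets borel \<and> integrable \<mu> (\<lambda>x. (norm x)\<^sup>2)}"

definition couplings ::
  "(real^'n) measure \<Rightarrow> (real^'n) measure \<Rightarrow> ((real^'n) \<times> (real^'n)) measure set" where
  "couplings \<mu> \<nu> = {\<gamma>. sets \<gamma> = sets (borel \<Otimes>\<^sub>M borel) \<and>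
      distr \<gamma> borel fst = \<mu> \<and> distr \<gamma> borel snd = \<nu>}"

(* The infimum is finite for measures in P2 (use the product coupling), so no information is
   lost by enn2real there. *)
definition W2 :: "(real^'n) measure \<Rightarrow> (real^'n) measure \<Rightarrow> real" where
  "W2 \<mu> \<nu> = sqrt (enn2real
     (INF \<gamma>\<in>couplings \<mu> \<nu>. \<integral>\<^sup>+ z. ennreal ((dist (fst z) (snd z))\<^sup>2) \<partial>\<gamma>))"

(* C([0,1]; P2); values of the curve outside of [0,1] are irrelevant. *)
definition P2_curves :: "(real \<Rightarrow> (real^'n) measure) set" where
  "P2_curves = {\<mu>. (\<forall>t\<in>{0..1}. \<mu> t \<in> P2) \<and>
      (\<forall>t\<in>{0..1}. ((\<lambda>s. W2 (\<mu> s) (\<mu> t)) \<longlongrightarrow> 0) (at t within {0..1}))}"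


subsection \<open>Square integrable fields\<close>

definition unit_time :: "real measure" where
  "unit_time = restrict_space lborel {0<..<1}"

definition L2 :: "'a measure \<Rightarrow> ('a \<Rightarrow> 'b::euclidean_space) set" where
  "L2 M = {f \<in> borel_measurable M. integrable M (\<lambda>x. (norm (f x))\<^sup>2)}"

definition skew :: "real^'n^'n \<Rightarrow> bool" where
  "skew A \<longleftrightarrow> transpose A = - A"

definition L2_so :: "(real \<Rightarrow> real^'n^'n) set" where
  "L2_so = {E \<in> L2 unit_time. \<forall>t\<in>{0<..<1}. skew (E t)}"

definition jointly_measurable :: "(real \<Rightarrow> real^'n \<Rightarrow> real^'n) \<Rightarrow> bool" where
  "jointly_measurable V \<longleftrightarrow>
     (\<lambda>(t, x). V t x) \<in> borel_measurable (unit_time \<Otimes>\<^sub>M borel)"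

(* The integral of |V|^2 with respect to d(mu t) dt. *)
definition kinetic_energy ::
  "(real \<Rightarrow> (real^'n) measure) \<Rightarrow> (real \<Rightarrow> real^'n \<Rightarrow> real^'n) \<Rightarrow> ennreal" where
  "kinetic_energy \<mu> V =
     (\<integral>\<^sup>+ t. (\<integral>\<^sup>+ x. ennreal ((norm (V t x))\<^sup>2) \<partial>\<mu> t) \<partial>unit_time)"

definition L2_path ::
  "(real \<Rightarrow> (real^'n) measure) \<Rightarrow> (real \<Rightarrow> real^'n \<Rightarrow> real^'n) set" where
  "L2_path \<mu> = {V. jointly_measurable V \<and> kinetic_energy \<mu> V < \<infinity>}"


subsection \<open>Continuity equation and the dynamic value\<close>

(* Weak form of d/dt mu + div (mu V) = 0 in D'((0,1) x R^d). *)
definition continuity_equation ::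
  "(real \<Rightarrow> (real^'n) measure) \<Rightarrow> (real \<Rightarrow> real^'n \<Rightarrow> real^'n) \<Rightarrow> bool" where
  "continuity_equation \<mu> V \<longleftrightarrow>
     (\<forall>\<phi>\<in>test_functions ({0<..<1} \<times> UNIV).
        (\<integral>t. (\<integral>x. deriv (\<lambda>s. \<phi> (s, x)) t + grad (\<lambda>y. \<phi> (t, y)) x \<bullet> V t x \<partial>\<mu> t) \<partial>unit_time)
          = 0)"

definition dbar_sq :: "(real^'n) measure \<Rightarrow> (real^'n) measure \<Rightarrow> ennreal" where
  "dbar_sq \<mu>\<^sub>0 \<mu>\<^sub>1 = Inf {kinetic_energy \<mu> V | \<mu> V E C.
      \<mu> \<in> P2_curves \<and> V \<in> L2_path \<mu> \<and> E \<in> L2_so \<and> C \<in> L2 unit_time \<and>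
      \<mu> 0 = \<mu>\<^sub>0 \<and> \<mu> 1 = \<mu>\<^sub>1 \<and>
      continuity_equation \<mu> (\<lambda>t x. V t x + E t *v x + C t)}"


subsection \<open>The MBB seminorm and the geometric action\<close>

(* Distributions on a Euclidean space are represented by their action on test functions. *)
type_synonym 'a distribution = "('a \<Rightarrow> real) \<Rightarrow> real"

definition dist_eq :: "(real^'n) distribution \<Rightarrow> (real^'n) distribution \<Rightarrow> bool" where
  "dist_eq \<xi> \<eta> \<longleftrightarrow> (\<forall>\<phi>\<in>test_functions UNIV. \<xi> \<phi> = \<eta> \<phi>)"

(* The distribution - div (mu V). *)
definition neg_div :: "(real^'n) measure \<Rightarrow> (real^'n \<Rightarrow> real^'n) \<Rightarrow> (real^'n) distribution" where
  "neg_div \<mu> V = (\<lambda>\<phi>. \<integral>x. grad \<phi> x \<bullet> V x \<partial>\<mu>)"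

definition rigid_fields :: "(real^'n) measure \<Rightarrow> (real^'n \<Rightarrow> real^'n) set" where
  "rigid_fields \<mu> = {r \<in> L2 \<mu>. \<exists>E C. skew E \<and> (AE x in \<mu>. r x = E *v x + C)}"

(* Squared MBB seminorm.  It is only of interest for xi in the tangent space at mu, the closure of
   {- div (mu V) | V smooth, compactly supported} in the dual norm of
   {phi | integral of |grad phi|^2 d mu <= 1}.  No domain restriction is needed: xi = - div (mu V)
   with V in L2 mu always lies in that closure (smooth compactly supported fields are dense in
   L2 mu, and V |-> - div (mu V) is a contraction), and for every other xi the infimum below is
   over the empty set, hence infinite. *)
definition mbb_sq :: "(real^'n) measure \<Rightarrow> (real^'n) distribution \<Rightarrow> ennreal" where
  "mbb_sq \<mu> \<xi> = Inf {(\<integral>\<^sup>+ x. ennreal ((norm (V x - r x))\<^sup>2) \<partial>\<mu>) | V r.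
      V \<in> L2 \<mu> \<and> r \<in> rigid_fields \<mu> \<and> dist_eq (neg_div \<mu> V) \<xi>}"

definition admissible ::
  "(real^'n) measure \<Rightarrow> (real^'n) measure \<Rightarrow>
   (real \<Rightarrow> (real^'n) measure) \<Rightarrow> (real \<Rightarrow> real^'n \<Rightarrow> real^'n) \<Rightarrow> bool" where
  "admissible \<mu>\<^sub>0 \<mu>\<^sub>1 \<mu> V \<longleftrightarrow> \<mu> \<in> P2_curves \<and> \<mu> 0 = \<mu>\<^sub>0 \<and> \<mu> 1 = \<mu>\<^sub>1 \<and>
     V \<in> L2_path \<mu> \<and> continuity_equation \<mu> V"

(* The time derivative of an admissible pair; for a.e. t it depends on the curve mu only. *)
definition time_deriv ::
  "(real \<Rightarrow> (real^'n) measure) \<Rightarrow> (real \<Rightarrow> real^'n \<Rightarrow> real^'n) \<Rightarrow> real \<Rightarrow> (real^'n) distribution" where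
  "time_deriv \<mu> V t = neg_div (\<mu> t) (V t)"

definition geometric_action ::
  "(real \<Rightarrow> (real^'n) measure) \<Rightarrow> (real \<Rightarrow> real^'n \<Rightarrow> real^'n) \<Rightarrow> ennreal" where
  "geometric_action \<mu> V = (\<integral>\<^sup>+ t. mbb_sq (\<mu> t) (time_deriv \<mu> V t) \<partial>unit_time)"

definition dgeom_sq :: "(real^'n) measure \<Rightarrow> (real^'n) measure \<Rightarrow> ennreal" where
  "dgeom_sq \<mu>\<^sub>0 \<mu>\<^sub>1 = Inf {geometric_action \<mu> V | \<mu> V. admissible \<mu>\<^sub>0 \<mu>\<^sub>1 \<mu> V}"

end

theory Submission
  imports Defs
begin

text \<open>
  A competitor \<open>(\<mu>, V, E, C)\<close> of the dynamic problem yields the admissible pair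
  \<open>(\<mu>, V + E x + C)\<close>, and subtracting the rigid field \<open>E x + C\<close> bounds its MBB seminorm by the
  norm of \<open>V\<close> at almost every time. Conversely, a nearly optimal selection \<open>(W, E, C)\<close> along an
  admissible curve yields the competitor \<open>(\<mu>, W - E x - C, E, C)\<close>: the continuity equation only
  depends on the divergences of the time slices of the velocity, so it passes to \<open>W\<close>. Rigid
  fields with square integrable coefficients have finite energy because second moments are
  bounded along a W2-continuous curve.
\<close>

subsection \<open>Couplings and the Wasserstein distance\<close>

lemma P2D:
  assumes "\<mu> \<in> P2"
  shows "prob_space \<mu>" "sets \<mu> = sets borel" "space \<mu> = UNIV" "integrable \<mu> (\<lambda>x. (norm x)\<^sup>2)"
  using assms sets_eq_imp_space_eq[of \<mu> borel] by (auto simp: P2_def)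

lemma nn_integral_couplings:
  assumes "\<gamma> \<in> couplings \<mu> \<nu>" and [measurable]: "f \<in> borel_measurable borel"
  shows "(\<integral>\<^sup>+z. f (fst z) \<partial>\<gamma>) = (\<integral>\<^sup>+x. f x \<partial>\<mu>)" "(\<integral>\<^sup>+z. f (snd z) \<partial>\<gamma>) = (\<integral>\<^sup>+x. f x \<partial>\<nu>)"
proof -
  have [measurable_cong]: "sets \<gamma> = sets (borel \<Otimes>\<^sub>M borel)"
    and eq: "distr \<gamma> borel fst = \<mu>" "distr \<gamma> borel snd = \<nu>"
    using assms by (auto simp: couplings_def)
  show "(\<integral>\<^sup>+z. f (fst z) \<partial>\<gamma>) = (\<integral>\<^sup>+x. f x \<partial>\<mu>)" "(\<integral>\<^sup>+z. f (snd z) \<partial>\<gamma>) = (\<integral>\<^sup>+x. f x \<partial>\<nu>)"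
    by (simp_all add: eq[symmetric] nn_integral_distr)
qed

lemma norm_add_sq_le:
  fixes x y :: "'a::real_normed_vector"
  shows "(norm (x + y))\<^sup>2 \<le> 2 * (norm x)\<^sup>2 + 2 * (norm y)\<^sup>2"
proof -
  have "(norm (x + y))\<^sup>2 \<le> (norm x + norm y)\<^sup>2"
    by (intro power_mono norm_triangle_ineq) auto
  also have "\<dots> \<le> 2 * (norm x)\<^sup>2 + 2 * (norm y)\<^sup>2"
    using sum_squares_bound[of "norm x" "norm y"] by (simp add: power2_sum)
  finally show ?thesis .
qed

lemma P2_nn_integral_norm_sq_finite:
  assumes "\<mu> \<in> P2"
  shows "(\<integral>\<^sup>+x. ennreal ((norm x)\<^sup>2) \<partial>\<mu>) < \<infinity>"
  using P2D(4)[OF assms] by (simp add: integrable_iff_bounded)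

text \<open>The product coupling keeps the infimum in \<open>W2\<close> from ranging over the empty
  set. Together with \<open>couplings_cost_le\<close> it makes that infimum finite.\<close>

lemma pair_measure_in_couplings:
  assumes "\<mu> \<in> P2" "\<nu> \<in> P2"
  shows "\<mu> \<Otimes>\<^sub>M \<nu> \<in> couplings \<mu> \<nu>"
proof -
  interpret \<mu>: prob_space \<mu> by (rule P2D[OF assms(1)])
  interpret \<nu>: prob_space \<nu> by (rule P2D[OF assms(2)])
  note [measurable_cong] = P2D(2)[OF assms(1)] P2D(2)[OF assms(2)]
  note sp = P2D(3)[OF assms(1)] P2D(3)[OF assms(2)]
  \<comment> \<open>\<open>couplings\<close> takes marginals on \<open>borel\<close>, while
    \<open>distr_pair_fst\<close> takes them on \<open>\<mu>\<close> itself; the two targets have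
    the same measurable sets.\<close>
  have "distr (\<mu> \<Otimes>\<^sub>M \<nu>) borel fst = distr (\<mu> \<Otimes>\<^sub>M \<nu>) \<mu> fst"
    by (intro distr_cong) (auto simp: P2D(2)[OF assms(1)])
  then have 1: "distr (\<mu> \<Otimes>\<^sub>M \<nu>) borel fst = \<mu>"
    by (simp add: \<nu>.distr_pair_fst)
  have 2: "distr (\<mu> \<Otimes>\<^sub>M \<nu>) borel snd = \<nu>"
  proof (rule measure_eqI)
    fix A assume "A \<in> sets (distr (\<mu> \<Otimes>\<^sub>M \<nu>) borel snd)"
    then have A: "A \<in> sets \<nu>" "A \<in> sets borel" by (auto simp: P2D(2)[OF assms(2)])
    have "emeasure (distr (\<mu> \<Otimes>\<^sub>M \<nu>) borel snd) A = emeasure (\<mu> \<Otimes>\<^sub>M \<nu>) (UNIV \<times> A)"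
      using A by (auto simp: emeasure_distr space_pair_measure sp intro!: arg_cong2[where f=emeasure])
    also have "\<dots> = emeasure \<mu> UNIV * emeasure \<nu> A"
      using A by (intro \<nu>.emeasure_pair_measure_Times) (auto simp: P2D(2)[OF assms(1)])
    also have "\<dots> = emeasure \<nu> A"
      using \<mu>.emeasure_space_1 by (simp add: sp)
    finally show "emeasure (distr (\<mu> \<Otimes>\<^sub>M \<nu>) borel snd) A = emeasure \<nu> A" .
  qed (simp add: P2D(2)[OF assms(2)])
  show ?thesis
    using 1 2 sets_pair_measure_cong[OF P2D(2)[OF assms(1)] P2D(2)[OF assms(2)]]
    by (simp add: couplings_def)
qed

text \<open>Integrates |x - y|^2 \<le> 2|x|^2 + 2|y|^2 and reads off the marginals, so that the cost
  of every coupling is controlled by second moments.\<close>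

lemma couplings_cost_le:
  assumes "\<gamma> \<in> couplings \<mu> \<nu>"
  shows "(\<integral>\<^sup>+z. ennreal ((dist (fst z) (snd z))\<^sup>2) \<partial>\<gamma>)
    \<le> 2 * (\<integral>\<^sup>+x. ennreal ((norm x)\<^sup>2) \<partial>\<mu>) + 2 * (\<integral>\<^sup>+x. ennreal ((norm x)\<^sup>2) \<partial>\<nu>)"
proof -
  have [measurable_cong]: "sets \<gamma> = sets (borel \<Otimes>\<^sub>M borel)"
    using assms by (auto simp: couplings_def)
  have "(\<integral>\<^sup>+z. ennreal ((dist (fst z) (snd z))\<^sup>2) \<partial>\<gamma>)
    \<le> (\<integral>\<^sup>+z. 2 * ennreal ((norm (fst z))\<^sup>2) + 2 * ennreal ((norm (snd z))\<^sup>2) \<partial>\<gamma>)"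
  proof (intro nn_integral_mono)
    fix z :: "(real^'a) \<times> (real^'a)"
    show "ennreal ((dist (fst z) (snd z))\<^sup>2)
        \<le> 2 * ennreal ((norm (fst z))\<^sup>2) + 2 * ennreal ((norm (snd z))\<^sup>2)"
      using ennreal_leI[OF norm_add_sq_le[of "fst z" "- snd z"]]
      by (simp add: dist_norm ennreal_plus ennreal_mult)
  qed
  also have "\<dots> = 2 * (\<integral>\<^sup>+z. ennreal ((norm (fst z))\<^sup>2) \<partial>\<gamma>) + 2 * (\<integral>\<^sup>+z. ennreal ((norm (snd z))\<^sup>2) \<partial>\<gamma>)"
    by (subst nn_integral_add) (auto simp: nn_integral_cmult)
  finally show ?thesis
    by (simp add: nn_integral_couplings[OF assms, of "\<lambda>x. ennreal ((norm x)\<^sup>2)"])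
qed

text \<open>Near-optimal couplings take the place of optimal ones. Since the infimum is finite,
  \<open>enn2real\<close> preserves its value, and any number strictly above an infimum is undercut
  by some member.\<close>

lemma ex_coupling_near_W2:
  assumes "\<mu> \<in> P2" "\<nu> \<in> P2" "e > 0"
  shows "\<exists>\<gamma>\<in>couplings \<mu> \<nu>.
    (\<integral>\<^sup>+z. ennreal ((dist (fst z) (snd z))\<^sup>2) \<partial>\<gamma>) < ennreal ((W2 \<mu> \<nu>)\<^sup>2 + e)"
proof -
  define I where "I = (INF \<gamma>\<in>couplings \<mu> \<nu>. \<integral>\<^sup>+z. ennreal ((dist (fst z) (snd z))\<^sup>2) \<partial>\<gamma>)"
  have "I \<le> (\<integral>\<^sup>+z. ennreal ((dist (fst z) (snd z))\<^sup>2) \<partial>(\<mu> \<Otimes>\<^sub>M \<nu>))"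
    unfolding I_def by (intro INF_lower pair_measure_in_couplings assms)
  also have "\<dots> \<le> 2 * (\<integral>\<^sup>+x. ennreal ((norm x)\<^sup>2) \<partial>\<mu>) + 2 * (\<integral>\<^sup>+x. ennreal ((norm x)\<^sup>2) \<partial>\<nu>)"
    by (intro couplings_cost_le pair_measure_in_couplings assms)
  also have "\<dots> < \<infinity>"
    using P2_nn_integral_norm_sq_finite[OF assms(1)] P2_nn_integral_norm_sq_finite[OF assms(2)]
    by (simp add: ennreal_mult_less_top)
  finally have "I < \<infinity>" .
  have "(W2 \<mu> \<nu>)\<^sup>2 = enn2real I"
    by (simp add: W2_def I_def)
  then have "I < ennreal ((W2 \<mu> \<nu>)\<^sup>2 + e)"
    using \<open>I < \<infinity>\<close> \<open>e > 0\<close> by (cases I) (auto simp: ennreal_less_iff)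
  then show ?thesis
    unfolding I_def INF_less_iff .
qed

text \<open>Follows from |x|^2 \<le> 2|x - y|^2 + 2|y|^2 under a near-optimal coupling. The summand
  1 is the slack chosen for that coupling; the bound serves only to transport finiteness of
  moments.\<close>

lemma nn_integral_norm_sq_le_W2:
  assumes "\<mu> \<in> P2" "\<nu> \<in> P2"
  shows "(\<integral>\<^sup>+x. ennreal ((norm x)\<^sup>2) \<partial>\<mu>)
    \<le> 2 * ennreal ((W2 \<mu> \<nu>)\<^sup>2 + 1) + 2 * (\<integral>\<^sup>+x. ennreal ((norm x)\<^sup>2) \<partial>\<nu>)"
proof -
  obtain \<gamma> where \<gamma>: "\<gamma> \<in> couplings \<mu> \<nu>"
    and le: "(\<integral>\<^sup>+z. ennreal ((dist (fst z) (snd z))\<^sup>2) \<partial>\<gamma>) < ennreal ((W2 \<mu> \<nu>)\<^sup>2 + 1)"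
    using ex_coupling_near_W2[OF assms, of 1] by auto
  have [measurable_cong]: "sets \<gamma> = sets (borel \<Otimes>\<^sub>M borel)"
    using \<gamma> by (auto simp: couplings_def)
  have "(\<integral>\<^sup>+x. ennreal ((norm x)\<^sup>2) \<partial>\<mu>) = (\<integral>\<^sup>+z. ennreal ((norm (fst z))\<^sup>2) \<partial>\<gamma>)"
    using nn_integral_couplings(1)[OF \<gamma>, of "\<lambda>x. ennreal ((norm x)\<^sup>2)"] by simp
  also have "\<dots> \<le> (\<integral>\<^sup>+z. 2 * ennreal ((dist (fst z) (snd z))\<^sup>2) + 2 * ennreal ((norm (snd z))\<^sup>2) \<partial>\<gamma>)"
  proof (intro nn_integral_mono)
    fix z :: "(real^'a) \<times> (real^'a)"
    show "ennreal ((norm (fst z))\<^sup>2)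
        \<le> 2 * ennreal ((dist (fst z) (snd z))\<^sup>2) + 2 * ennreal ((norm (snd z))\<^sup>2)"
      using ennreal_leI[OF norm_add_sq_le[of "fst z - snd z" "snd z"]]
      by (simp add: dist_norm ennreal_plus ennreal_mult)
  qed
  also have "\<dots> = 2 * (\<integral>\<^sup>+z. ennreal ((dist (fst z) (snd z))\<^sup>2) \<partial>\<gamma>) + 2 * (\<integral>\<^sup>+z. ennreal ((norm (snd z))\<^sup>2) \<partial>\<gamma>)"
    by (subst nn_integral_add) (auto simp: nn_integral_cmult)
  also have "\<dots> \<le> 2 * ennreal ((W2 \<mu> \<nu>)\<^sup>2 + 1) + 2 * (\<integral>\<^sup>+x. ennreal ((norm x)\<^sup>2) \<partial>\<nu>)"
    using less_imp_le[OF le]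
    by (intro add_mono mult_left_mono)
      (simp_all add: nn_integral_couplings(2)[OF \<gamma>, of "\<lambda>x. ennreal ((norm x)\<^sup>2)"] del: ennreal_plus)
  finally show ?thesis .
qed

text \<open>The easy half of Kantorovich duality combined with Jensen: under a coupling the
  difference of integrals is at most L times the mean distance, which is at most the root of the
  mean squared distance.\<close>

lemma Lipschitz_integral_diff_le_W2:
  assumes "\<mu> \<in> P2" "\<nu> \<in> P2"
    and lip: "\<And>x y. \<bar>f x - f y\<bar> \<le> L * dist x y"
    and bdd: "\<And>x. \<bar>f x\<bar> \<le> B" and [measurable]: "f \<in> borel_measurable borel"
    and "L \<ge> 0"
  shows "\<bar>(\<integral>x. f x \<partial>\<mu>) - (\<integral>x. f x \<partial>\<nu>)\<bar> \<le> L * W2 \<mu> \<nu>"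
proof -
  have "\<bar>(\<integral>x. f x \<partial>\<mu>) - (\<integral>x. f x \<partial>\<nu>)\<bar> \<le> L * sqrt ((W2 \<mu> \<nu>)\<^sup>2 + e)" if e: "e > 0" for e
  proof -
    obtain \<gamma> where \<gamma>: "\<gamma> \<in> couplings \<mu> \<nu>"
      and le: "(\<integral>\<^sup>+z. ennreal ((dist (fst z) (snd z))\<^sup>2) \<partial>\<gamma>) < ennreal ((W2 \<mu> \<nu>)\<^sup>2 + e)"
      using ex_coupling_near_W2[OF assms(1,2) e] by auto
    have [measurable_cong]: "sets \<gamma> = sets (borel \<Otimes>\<^sub>M borel)"
      and eq: "distr \<gamma> borel fst = \<mu>" "distr \<gamma> borel snd = \<nu>"
      using \<gamma> by (auto simp: couplings_def)
    \<comment> \<open>\<open>couplings\<close> does not demand total mass 1; it is inherited from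
      the first marginal.\<close>
    interpret \<gamma>: prob_space \<gamma>
      by (rule prob_space_distrD[of fst _ borel]) (use P2D[OF assms(1)] eq in auto)
    define D where "D = (\<lambda>z::(real^'a)\<times>(real^'a). dist (fst z) (snd z))"
    have [measurable]: "D \<in> borel_measurable \<gamma>" unfolding D_def by measurable
    have D2: "integrable \<gamma> (\<lambda>z. (D z)\<^sup>2)"
      using le by (intro integrableI_bounded) (auto simp: D_def intro: less_trans)
    have D1: "integrable \<gamma> D"
      by (rule \<gamma>.square_integrable_imp_integrable[OF _ D2]) measurable
    have "ennreal (\<integral>z. (D z)\<^sup>2 \<partial>\<gamma>) = (\<integral>\<^sup>+z. ennreal ((D z)\<^sup>2) \<partial>\<gamma>)"
      by (rule nn_integral_eq_integral[symmetric, OF D2]) auto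
    also have "\<dots> \<le> ennreal ((W2 \<mu> \<nu>)\<^sup>2 + e)"
      using less_imp_le[OF le] by (simp only: D_def)
    finally have "(\<integral>z. (D z)\<^sup>2 \<partial>\<gamma>) \<le> (W2 \<mu> \<nu>)\<^sup>2 + e"
      by (subst (asm) ennreal_le_iff) (use e in auto)
    \<comment> \<open>Jensen for the square, in the form that the variance of \<open>D\<close> is
      nonnegative.\<close>
    moreover have "(\<integral>z. D z \<partial>\<gamma>)\<^sup>2 \<le> (\<integral>z. (D z)\<^sup>2 \<partial>\<gamma>)"
      using \<gamma>.variance_eq[OF D1 D2] \<gamma>.variance_positive[of D] by simp
    ultimately have ED: "(\<integral>z. D z \<partial>\<gamma>) \<le> sqrt ((W2 \<mu> \<nu>)\<^sup>2 + e)"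
      by (intro real_le_rsqrt) simp
    have int: "integrable \<gamma> (\<lambda>z. f (fst z))" "integrable \<gamma> (\<lambda>z. f (snd z))"
      using bdd by (auto intro!: \<gamma>.integrable_const_bound[where B=B])
    have "(\<integral>x. f x \<partial>\<mu>) - (\<integral>x. f x \<partial>\<nu>) = (\<integral>z. f (fst z) - f (snd z) \<partial>\<gamma>)"
      using int by (simp add: eq[symmetric] integral_distr)
    also have "\<bar>\<dots>\<bar> \<le> (\<integral>z. \<bar>f (fst z) - f (snd z)\<bar> \<partial>\<gamma>)"
      by (rule integral_abs_bound)
    also have "\<dots> \<le> (\<integral>z. L * D z \<partial>\<gamma>)"
      using int D1 lip by (intro integral_mono) (auto simp: D_def)
    also have "\<dots> \<le> L * sqrt ((W2 \<mu> \<nu>)\<^sup>2 + e)"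
      using ED \<open>L \<ge> 0\<close> by (simp add: mult_left_mono)
    finally show ?thesis .
  qed
  \<comment> \<open>The slack of the coupling is removed by letting \<open>e\<close> tend to 0 from
    the right.\<close>
  then have "eventually (\<lambda>e. \<bar>(\<integral>x. f x \<partial>\<mu>) - (\<integral>x. f x \<partial>\<nu>)\<bar> \<le> L * sqrt ((W2 \<mu> \<nu>)\<^sup>2 + e)) (at_right 0)"
    by (auto simp: eventually_at_right_less eventually_at_filter)
  moreover have "((\<lambda>e. L * sqrt ((W2 \<mu> \<nu>)\<^sup>2 + e)) \<longlongrightarrow> L * sqrt ((W2 \<mu> \<nu>)\<^sup>2 + 0)) (at_right 0)"
    by (intro tendsto_intros)
  ultimately have "\<bar>(\<integral>x. f x \<partial>\<mu>) - (\<integral>x. f x \<partial>\<nu>)\<bar> \<le> L * sqrt ((W2 \<mu> \<nu>)\<^sup>2 + 0)"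
    by (intro tendsto_lowerbound) auto
  moreover have "W2 \<mu> \<nu> \<ge> 0" by (simp add: W2_def)
  ultimately show ?thesis by simp
qed

text \<open>Compactness of the time interval: \<open>W2\<close>-continuity bounds the moments near
  each time by the moment at that time, and Bolzano bisection glues the local bounds.\<close>

lemma P2_curves_moment_bound:
  assumes "\<mu> \<in> P2_curves"
  shows "\<exists>K\<ge>0. \<forall>t\<in>{0..1}. (\<integral>\<^sup>+x. ennreal ((norm x)\<^sup>2) \<partial>\<mu> t) \<le> ennreal K"
proof -
  have P2: "\<mu> t \<in> P2" if "t \<in> {0..1}" for t using assms that by (auto simp: P2_curves_def)
  \<comment> \<open>Intersecting with \<open>{0..1}\<close> is needed because the local case of
    \<open>Bolzano\<close> admits intervals that stick out of [0,1], where the curve is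
    arbitrary.\<close>
  define P where "P a b \<longleftrightarrow>
    (\<exists>K\<ge>0. \<forall>t\<in>{0..1} \<inter> {a..b}. (\<integral>\<^sup>+x. ennreal ((norm x)\<^sup>2) \<partial>\<mu> t) \<le> ennreal K)" for a b
  have "(0::real) \<le> 1" by simp
  then have "P 0 1"
  proof (induction rule: Bolzano)
    case (trans a b c)
    then obtain K L where K: "K \<ge> 0" "\<forall>t\<in>{0..1} \<inter> {a..b}. (\<integral>\<^sup>+x. ennreal ((norm x)\<^sup>2) \<partial>\<mu> t) \<le> ennreal K"
      and L: "L \<ge> 0" "\<forall>t\<in>{0..1} \<inter> {b..c}. (\<integral>\<^sup>+x. ennreal ((norm x)\<^sup>2) \<partial>\<mu> t) \<le> ennreal L"
      by (auto simp: P_def)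
    have "\<forall>t\<in>{0..1} \<inter> {a..c}. (\<integral>\<^sup>+x. ennreal ((norm x)\<^sup>2) \<partial>\<mu> t) \<le> ennreal (max K L)"
    proof
      fix t assume t: "t \<in> {0..1} \<inter> {a..c}"
      show "(\<integral>\<^sup>+x. ennreal ((norm x)\<^sup>2) \<partial>\<mu> t) \<le> ennreal (max K L)"
      proof (cases "t \<le> b")
        case True
        with t K(2) have "(\<integral>\<^sup>+x. ennreal ((norm x)\<^sup>2) \<partial>\<mu> t) \<le> ennreal K" by auto
        then show ?thesis by (rule order_trans) (auto intro: ennreal_leI)
      next
        case False
        with t L(2) have "(\<integral>\<^sup>+x. ennreal ((norm x)\<^sup>2) \<partial>\<mu> t) \<le> ennreal L" by auto
        then show ?thesis by (rule order_trans) (auto intro: ennreal_leI)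
      qed
    qed
    then show ?case unfolding P_def using K(1) by (intro exI[of _ "max K L"]) simp
  next
    case (local t)
    then have t: "t \<in> {0..1}" by auto
    then have "((\<lambda>s. W2 (\<mu> s) (\<mu> t)) \<longlongrightarrow> 0) (at t within {0..1})"
      using assms by (auto simp: P2_curves_def)
    then have "eventually (\<lambda>s. W2 (\<mu> s) (\<mu> t) < 1) (at t within {0..1})"
      by (rule order_tendstoD) simp
    then obtain d where d: "d > 0" "\<And>s. s \<in> {0..1} \<Longrightarrow> s \<noteq> t \<Longrightarrow> dist s t < d \<Longrightarrow> W2 (\<mu> s) (\<mu> t) < 1"
      unfolding eventually_at by auto
    obtain m where m: "m \<ge> 0" "(\<integral>\<^sup>+x. ennreal ((norm x)\<^sup>2) \<partial>\<mu> t) = ennreal m"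
      using P2_nn_integral_norm_sq_finite[OF P2[OF t]]
      by (cases "\<integral>\<^sup>+x. ennreal ((norm x)\<^sup>2) \<partial>\<mu> t") auto
    \<comment> \<open>The constant is 2 (W2^2 + 1) + 2 m with W2 < 1. The case \<open>s = t\<close>
      is separate, since the punctured limit says nothing there.\<close>
    have *: "(\<integral>\<^sup>+x. ennreal ((norm x)\<^sup>2) \<partial>\<mu> s) \<le> ennreal (4 + 2 * m)"
      if s: "s \<in> {0..1}" "dist s t < d" for s
    proof (cases "s = t")
      case True
      then show ?thesis using m(1) unfolding True m(2) by (intro ennreal_leI) simp
    next
      case False
      then have "W2 (\<mu> s) (\<mu> t) < 1" using d(2) s by auto
      moreover have "W2 (\<mu> s) (\<mu> t) \<ge> 0" by (simp add: W2_def)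
      ultimately have "(W2 (\<mu> s) (\<mu> t))\<^sup>2 \<le> 1"
        by (simp add: power_le_one)
      then have le: "2 * ennreal ((W2 (\<mu> s) (\<mu> t))\<^sup>2 + 1) \<le> 2 * ennreal 2"
        by (intro mult_left_mono ennreal_leI) auto
      have "(\<integral>\<^sup>+x. ennreal ((norm x)\<^sup>2) \<partial>\<mu> s) \<le> 2 * ennreal 2 + 2 * ennreal m"
        using order_trans[OF nn_integral_norm_sq_le_W2[OF P2[OF s(1)] P2[OF t]] add_right_mono[OF le]]
        unfolding m(2) .
      also have "\<dots> = ennreal (4 + 2 * m)"
        using m(1) by (subst ennreal_plus) (simp_all add: ennreal_mult)
      finally show ?thesis .
    qed
    have "P a b" if "a \<le> t" "t \<le> b" "b - a < d" for a b
      unfolding P_def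
    proof (intro exI[of _ "4 + 2 * m"] conjI ballI)
      show "0 \<le> 4 + 2 * m" using m(1) by simp
      fix s assume "s \<in> {0..1} \<inter> {a..b}"
      then show "(\<integral>\<^sup>+x. ennreal ((norm x)\<^sup>2) \<partial>\<mu> s) \<le> ennreal (4 + 2 * m)"
        using that by (intro *) (auto simp: dist_real_def)
    qed
    with d(1) show ?case by blast
  qed
  then show ?thesis by (auto simp: P_def)
qed

subsection \<open>Square integrable fields along a curve\<close>

lemma space_unit_time [simp]: "space unit_time = {0<..<1}"
  by (simp add: unit_time_def space_restrict_space)

lemma P2_curves_P2: "\<mu> \<in> P2_curves \<Longrightarrow> t \<in> {0..1} \<Longrightarrow> \<mu> t \<in> P2"
  by (simp add: P2_curves_def)

text \<open>\<open>W2\<close> dominates the change of the integral of a bounded Lipschitz function,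
  so this integral is even continuous in time.\<close>

lemma P2_curves_integral_Lipschitz_measurable:
  assumes \<mu>: "\<mu> \<in> P2_curves"
    and lip: "\<And>x y. \<bar>f x - f y\<bar> \<le> L * dist x y"
    and bdd: "\<And>x. \<bar>f x\<bar> \<le> B" and f: "f \<in> borel_measurable borel"
    and "L \<ge> 0"
  shows "(\<lambda>t. \<integral>x. f x \<partial>\<mu> t) \<in> borel_measurable unit_time"
proof -
  have "continuous_on {0..1} (\<lambda>t. \<integral>x. f x \<partial>\<mu> t)"
    unfolding continuous_on_def
  proof
    fix t :: real assume t: "t \<in> {0..1}"
    have "((\<lambda>s. W2 (\<mu> s) (\<mu> t)) \<longlongrightarrow> 0) (at t within {0..1})"
      using \<mu> t by (auto simp: P2_curves_def)
    then have lim: "((\<lambda>s. L * W2 (\<mu> s) (\<mu> t)) \<longlongrightarrow> 0) (at t within {0..1})"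
      by (auto intro: tendsto_mult_right_zero)
    have "eventually (\<lambda>s. norm ((\<integral>x. f x \<partial>\<mu> s) - (\<integral>x. f x \<partial>\<mu> t)) \<le> L * W2 (\<mu> s) (\<mu> t))
        (at t within {0..1})"
      unfolding eventually_at_filter real_norm_def
      by (intro always_eventually allI impI
          Lipschitz_integral_diff_le_W2[OF P2_curves_P2[OF \<mu>] P2_curves_P2[OF \<mu> t] lip bdd f \<open>L \<ge> 0\<close>])
    then have "((\<lambda>s. (\<integral>x. f x \<partial>\<mu> s) - (\<integral>x. f x \<partial>\<mu> t)) \<longlongrightarrow> 0) (at t within {0..1})"
      by (rule Lim_null_comparison[OF _ lim])
    then show "((\<lambda>s. \<integral>x. f x \<partial>\<mu> s) \<longlongrightarrow> (\<integral>x. f x \<partial>\<mu> t)) (at t within {0..1})"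
      by (simp add: LIM_zero_iff)
  qed
  then have "continuous_on {0<..<1} (\<lambda>t. \<integral>x. f x \<partial>\<mu> t)"
    by (rule continuous_on_subset) auto
  then have "(\<lambda>t. \<integral>x. f x \<partial>\<mu> t) \<in> borel_measurable (restrict_space borel {0<..<1})"
    by (rule borel_measurable_continuous_on_restrict)
  moreover have "sets (restrict_space borel {0<..<1}) = sets unit_time"
    unfolding unit_time_def by (rule sets_restrict_space_cong) simp
  ultimately show ?thesis
    using measurable_cong_sets[OF _ refl] by blast
qed

text \<open>Needed for every manipulation of the time integrals: on a non-measurable integrand the
nonnegative integral is only a lower integral, which is not additive, and the Bochner integral
is 0. Indicators of open sets are limits of Lipschitz functions, whose integrals are
W2-continuous in time.\<close>

lemma P2_curves_measurable:
  assumes \<mu>: "\<mu> \<in> P2_curves"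
  shows "\<mu> \<in> measurable unit_time (subprob_algebra borel)"
proof (rule measurable_subprob_algebra_generated)
  show "sets borel = sigma_sets UNIV {S::(real^'a) set. open S}"
    by (simp add: borel_def)
  show "Int_stable {S::(real^'a) set. open S}"
    by (auto simp: Int_stable_def)
  show "{S::(real^'a) set. open S} \<subseteq> Pow UNIV" by auto
next
  fix t assume "t \<in> space unit_time"
  then have *: "\<mu> t \<in> P2" using P2_curves_P2[OF \<mu>, of t] by auto
  show "subprob_space (\<mu> t)" using P2D(1)[OF *] by (rule prob_space_imp_subprob_space)
  show "sets (\<mu> t) = sets borel" by (rule P2D[OF *])
next
  have UN: "emeasure (\<mu> t) UNIV = 1" if "t \<in> space unit_time" for t
  proof -
    have *: "\<mu> t \<in> P2" using P2_curves_P2[OF \<mu>, of t] that by auto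
    show ?thesis using prob_space.emeasure_space_1[OF P2D(1)[OF *]] by (simp add: P2D(3)[OF *])
  qed
  show UNIV: "(\<lambda>t. emeasure (\<mu> t) UNIV) \<in> borel_measurable unit_time"
    by (subst measurable_cong[OF UN]) auto
  fix U :: "(real^'a) set" assume "U \<in> {S. open S}"
  then have "open U" by simp
  then have [measurable]: "U \<in> sets borel" by simp
  show "(\<lambda>t. emeasure (\<mu> t) U) \<in> borel_measurable unit_time"
  \<comment> \<open>The whole space is set apart because \<open>infdist\<close> to the empty set is
    0 by convention, which would make the approximants below vanish.\<close>
  proof (cases "U = UNIV")
    case True
    then show ?thesis using UNIV by simp
  next
    case False
    \<comment> \<open>Each \<open>f k\<close> is \<open>k\<close>-Lipschitz with values in [0,1] and
      vanishes off \<open>U\<close>. On \<open>U\<close> the distance to the closed complement is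
      positive, so \<open>f k\<close> is eventually 1 at every point of \<open>U\<close>.\<close>
    define f where "f k x = min 1 (real k * infdist x (- U))" for k x
    have f_meas: "f k \<in> borel_measurable borel" for k
      unfolding f_def by (intro borel_measurable_continuous_onI continuous_intros)
    have lim_f: "(\<lambda>k. f k x) \<longlonglongrightarrow> indicator U x" for x
    proof (cases "x \<in> U")
      case True
      then have "infdist x (- U) \<noteq> 0"
        using in_closed_iff_infdist_zero[of "- U" x] \<open>open U\<close> False by auto
      then have pos: "infdist x (- U) > 0"
        using infdist_nonneg[of x "- U"] by linarith
      obtain N where N: "1 \<le> real N * infdist x (- U)"
        using reals_Archimedean3[OF pos] by (meson less_imp_le)
      have "eventually (\<lambda>k. f k x = 1) sequentially"
        using eventually_ge_at_top[of N]
      proof eventually_elim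
        case (elim k)
        then have "real N * infdist x (- U) \<le> real k * infdist x (- U)"
          using pos by (intro mult_right_mono) auto
        with N show ?case by (simp add: f_def)
      qed
      then show ?thesis using True by (simp add: tendsto_eventually)
    next
      case False
      then show ?thesis by (simp add: f_def)
    qed
    have "(\<lambda>t. \<integral>x. f k x \<partial>\<mu> t) \<in> borel_measurable unit_time" for k
    proof (rule P2_curves_integral_Lipschitz_measurable[OF \<mu>, where L="real k" and B=1])
      fix x y
      \<comment> \<open>Truncation at 1 does not increase distances.\<close>
      have "\<bar>f k x - f k y\<bar> \<le> \<bar>real k * infdist x (- U) - real k * infdist y (- U)\<bar>"
        unfolding f_def by linarith
      also have "\<dots> = real k * \<bar>infdist x (- U) - infdist y (- U)\<bar>"
        by (simp add: abs_mult flip: right_diff_distrib)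
      also have "\<dots> \<le> real k * dist x y"
        by (intro mult_left_mono infdist_triangle_abs) auto
      finally show "\<bar>f k x - f k y\<bar> \<le> real k * dist x y" .
      have "0 \<le> f k x" by (simp add: f_def infdist_nonneg)
      moreover have "f k x \<le> 1" by (simp add: f_def)
      ultimately show "\<bar>f k x\<bar> \<le> 1" by simp
    qed (use f_meas in auto)
    moreover have "(\<lambda>k. \<integral>x. f k x \<partial>\<mu> t) \<longlonglongrightarrow> measure (\<mu> t) U" if "t \<in> space unit_time" for t
    proof -
      have *: "\<mu> t \<in> P2" using P2_curves_P2[OF \<mu>, of t] that by auto
      interpret prob_space "\<mu> t" by (rule P2D[OF *])
      have [measurable_cong]: "sets (\<mu> t) = sets borel" by (rule P2D[OF *])
      have "(\<lambda>k. \<integral>x. f k x \<partial>\<mu> t) \<longlonglongrightarrow> (\<integral>x. indicator U x \<partial>\<mu> t)"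
      proof (rule integral_dominated_convergence[where w="\<lambda>_. 1"])
        show "AE x in \<mu> t. norm (f k x) \<le> 1" for k
          by (auto simp: f_def infdist_nonneg min_def not_le)
        show "f k \<in> borel_measurable (\<mu> t)" for k
          using f_meas[of k] by measurable
        show "AE x in \<mu> t. (\<lambda>k. f k x) \<longlonglongrightarrow> indicator U x"
          using lim_f by simp
      qed auto
      then show ?thesis by (simp add: P2D(3)[OF *])
    qed
    ultimately have "(\<lambda>t. measure (\<mu> t) U) \<in> borel_measurable unit_time"
      by (rule borel_measurable_LIMSEQ_real[rotated])
    then have "(\<lambda>t. ennreal (measure (\<mu> t) U)) \<in> borel_measurable unit_time"
      by measurable
    moreover have "emeasure (\<mu> t) U = ennreal (measure (\<mu> t) U)" if "t \<in> space unit_time" for t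
    proof -
      have *: "\<mu> t \<in> P2" using P2_curves_P2[OF \<mu>, of t] that by auto
      interpret prob_space "\<mu> t" by (rule P2D[OF *])
      show ?thesis by (rule emeasure_eq_measure)
    qed
    ultimately show ?thesis by (subst measurable_cong)
  qed
qed

section \<open>Energies, time slices and sums of time-dependent fields\<close>

lemma kinetic_energy_inner_measurable:
  assumes "\<mu> \<in> P2_curves" "jointly_measurable V"
  shows "(\<lambda>t. \<integral>\<^sup>+x. ennreal ((norm (V t x))\<^sup>2) \<partial>\<mu> t) \<in> borel_measurable unit_time"
proof (rule nn_integral_measurable_subprob_algebra2[OF _ P2_curves_measurable[OF assms(1)]])
  have [measurable]: "(\<lambda>(t, x). V t x) \<in> borel_measurable (unit_time \<Otimes>\<^sub>M borel)"
    using assms(2) by (simp add: jointly_measurable_def)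
  have "(\<lambda>p. ennreal ((norm ((\<lambda>(t, x). V t x) p))\<^sup>2)) \<in> borel_measurable (unit_time \<Otimes>\<^sub>M borel)"
    by measurable
  then show "(\<lambda>(t, x). ennreal ((norm (V t x))\<^sup>2)) \<in> borel_measurable (unit_time \<Otimes>\<^sub>M borel)"
    by (simp add: case_prod_beta')
qed

lemma jointly_measurable_slice:
  assumes "jointly_measurable V" "t \<in> {0<..<1}"
  shows "V t \<in> borel_measurable borel"
proof -
  have "(\<lambda>x. (\<lambda>(t, x). V t x) (t, x)) \<in> borel_measurable borel"
    using assms by (intro measurable_compose[OF measurable_Pair1'])
      (auto simp: jointly_measurable_def)
  then show ?thesis by simp
qed

lemma L2_path_add:
  assumes \<mu>: "\<mu> \<in> P2_curves" and V: "V \<in> L2_path \<mu>" and W: "W \<in> L2_path \<mu>"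
  shows "(\<lambda>t x. V t x + W t x) \<in> L2_path \<mu>"
proof -
  have jm: "jointly_measurable V" "jointly_measurable W"
    using V W by (auto simp: L2_path_def)
  then have [measurable]: "(\<lambda>(t, x). V t x) \<in> borel_measurable (unit_time \<Otimes>\<^sub>M borel)"
    "(\<lambda>(t, x). W t x) \<in> borel_measurable (unit_time \<Otimes>\<^sub>M borel)"
    by (simp_all add: jointly_measurable_def)
  have "(\<lambda>p. (\<lambda>(t, x). V t x) p + (\<lambda>(t, x). W t x) p) \<in> borel_measurable (unit_time \<Otimes>\<^sub>M borel)"
    by measurable
  then have jm_add: "jointly_measurable (\<lambda>t x. V t x + W t x)"
    by (simp add: jointly_measurable_def case_prod_beta')
  have "kinetic_energy \<mu> (\<lambda>t x. V t x + W t x)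
      \<le> (\<integral>\<^sup>+t. 2 * (\<integral>\<^sup>+x. ennreal ((norm (V t x))\<^sup>2) \<partial>\<mu> t) +
                2 * (\<integral>\<^sup>+x. ennreal ((norm (W t x))\<^sup>2) \<partial>\<mu> t) \<partial>unit_time)"
    unfolding kinetic_energy_def
  proof (rule nn_integral_mono)
    fix t assume t: "t \<in> space unit_time"
    then have P2: "\<mu> t \<in> P2" using P2_curves_P2[OF \<mu>, of t] by auto
    note [measurable_cong] = P2D(2)[OF P2]
    have [measurable]: "V t \<in> borel_measurable borel" "W t \<in> borel_measurable borel"
      using t jm by (auto intro: jointly_measurable_slice)
    have "(\<integral>\<^sup>+x. ennreal ((norm (V t x + W t x))\<^sup>2) \<partial>\<mu> t)
        \<le> (\<integral>\<^sup>+x. 2 * ennreal ((norm (V t x))\<^sup>2) + 2 * ennreal ((norm (W t x))\<^sup>2) \<partial>\<mu> t)"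
    proof (intro nn_integral_mono)
      fix x
      show "ennreal ((norm (V t x + W t x))\<^sup>2)
          \<le> 2 * ennreal ((norm (V t x))\<^sup>2) + 2 * ennreal ((norm (W t x))\<^sup>2)"
        using ennreal_leI[OF norm_add_sq_le[of "V t x" "W t x"]]
        by (simp add: ennreal_plus ennreal_mult)
    qed
    then show "(\<integral>\<^sup>+x. ennreal ((norm (V t x + W t x))\<^sup>2) \<partial>\<mu> t)
        \<le> 2 * (\<integral>\<^sup>+x. ennreal ((norm (V t x))\<^sup>2) \<partial>\<mu> t) +
            2 * (\<integral>\<^sup>+x. ennreal ((norm (W t x))\<^sup>2) \<partial>\<mu> t)"
      by (subst (asm) nn_integral_add) (auto simp: nn_integral_cmult)
  qed
  \<comment> \<open>Splitting the outer integral uses that both slice energies are measurable in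
    time.\<close>
  also have "\<dots> = 2 * kinetic_energy \<mu> V + 2 * kinetic_energy \<mu> W"
    using kinetic_energy_inner_measurable[OF \<mu> jm(1)] kinetic_energy_inner_measurable[OF \<mu> jm(2)]
    unfolding kinetic_energy_def by (subst nn_integral_add) (auto simp: nn_integral_cmult)
  also have "\<dots> < \<infinity>"
    using V W by (simp add: L2_path_def ennreal_mult_less_top)
  finally show ?thesis using jm_add by (simp add: L2_path_def)
qed

text \<open>A finite time integral forces the slice energy to be finite at almost every time.
  Exceptional times may remain, hence the almost-everywhere form of the later slice
  arguments.\<close>

lemma AE_L2_path_slice:
  assumes \<mu>: "\<mu> \<in> P2_curves" and V: "V \<in> L2_path \<mu>"
  shows "AE t in unit_time. V t \<in> L2 (\<mu> t)"
proof -
  have jm: "jointly_measurable V" using V by (simp add: L2_path_def)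
  have "AE t in unit_time. (\<integral>\<^sup>+x. ennreal ((norm (V t x))\<^sup>2) \<partial>\<mu> t) \<noteq> \<infinity>"
    using V by (intro nn_integral_PInf_AE kinetic_energy_inner_measurable[OF \<mu> jm])
      (auto simp: L2_path_def kinetic_energy_def)
  then show ?thesis
  proof (rule AE_mp, intro AE_I2 impI)
    fix t assume t: "t \<in> space unit_time"
      and fin: "(\<integral>\<^sup>+x. ennreal ((norm (V t x))\<^sup>2) \<partial>\<mu> t) \<noteq> \<infinity>"
    then have P2: "\<mu> t \<in> P2" using P2_curves_P2[OF \<mu>, of t] by auto
    note [measurable_cong] = P2D(2)[OF P2]
    have [measurable]: "V t \<in> borel_measurable borel"
      using t jm by (auto intro: jointly_measurable_slice)
    show "V t \<in> L2 (\<mu> t)"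
      using fin by (auto simp: L2_def less_top intro!: integrableI_bounded)
  qed
qed

text \<open>Supplies both the norm bound and the joint continuity of matrix-vector multiplication,
  which give the energy and the measurability of rigid fields.\<close>

lemma bounded_bilinear_matrix_vector_mult:
  "bounded_bilinear ((*v) :: real^'n^'m \<Rightarrow> real^'n \<Rightarrow> real^'m)"
  unfolding bilinear_conv_bounded_bilinear[symmetric] bilinear_def
  by (auto intro!: linearI simp: matrix_vector_mult_add_rdistrib matrix_vector_right_distrib
      scaleR_matrix_vector_assoc matrix_vector_mult_scaleR)

text \<open>The linear part has slice energy at most a constant times |E_t|^2 times the second
  moment, and the moments are bounded uniformly in time. The translation part has slice energy
  |C_t|^2, as each \<open>\<mu> t\<close> has mass 1.\<close>

lemma rigid_path_in_L2_path:
  assumes \<mu>: "\<mu> \<in> P2_curves" and E: "E \<in> L2 unit_time" and C: "C \<in> L2 unit_time"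
  shows "(\<lambda>t x. E t *v x + C t) \<in> L2_path \<mu>"
proof -
  interpret mv: bounded_bilinear "(*v) :: real^'a^'a \<Rightarrow> real^'a \<Rightarrow> real^'a"
    by (rule bounded_bilinear_matrix_vector_mult)
  have [measurable]: "E \<in> borel_measurable unit_time" "C \<in> borel_measurable unit_time"
    and int: "integrable unit_time (\<lambda>t. (norm (E t))\<^sup>2)" "integrable unit_time (\<lambda>t. (norm (C t))\<^sup>2)"
    using E C by (auto simp: L2_def)
  obtain B where B: "B > 0" "\<And>A x. norm (A *v x :: real^'a) \<le> norm (A :: real^'a^'a) * norm x * B"
    using mv.pos_bounded by auto
  obtain K where K: "K \<ge> 0" "\<And>t. t \<in> {0..1} \<Longrightarrow> (\<integral>\<^sup>+x. ennreal ((norm x)\<^sup>2) \<partial>\<mu> t) \<le> ennreal K"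
    using P2_curves_moment_bound[OF \<mu>] by auto
  have "(\<lambda>p. E (fst p) *v snd p) \<in> borel_measurable (unit_time \<Otimes>\<^sub>M borel)"
    by (rule borel_measurable_continuous_Pair) (auto intro!: mv.continuous_on continuous_intros)
  then have "jointly_measurable (\<lambda>t x. E t *v x)"
    by (simp add: jointly_measurable_def case_prod_beta')
  moreover have "kinetic_energy \<mu> (\<lambda>t x. E t *v x) < \<infinity>"
  proof -
    have "kinetic_energy \<mu> (\<lambda>t x. E t *v x) \<le> (\<integral>\<^sup>+t. ennreal (B\<^sup>2 * K) * ennreal ((norm (E t))\<^sup>2) \<partial>unit_time)"
      unfolding kinetic_energy_def
    proof (rule nn_integral_mono)
      fix t assume "t \<in> space unit_time"
      then have t: "t \<in> {0..1}" by auto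
      note [measurable_cong] = P2D(2)[OF P2_curves_P2[OF \<mu> t]]
      have "(\<integral>\<^sup>+x. ennreal ((norm (E t *v x))\<^sup>2) \<partial>\<mu> t)
          \<le> (\<integral>\<^sup>+x. ennreal (B\<^sup>2 * (norm (E t))\<^sup>2) * ennreal ((norm x)\<^sup>2) \<partial>\<mu> t)"
      proof (rule nn_integral_mono)
        fix x
        have "(norm (E t *v x))\<^sup>2 \<le> (norm (E t) * norm x * B)\<^sup>2"
          by (intro power_mono B) auto
        also have "\<dots> = B\<^sup>2 * (norm (E t))\<^sup>2 * (norm x)\<^sup>2"
          by (simp add: power_mult_distrib)
        finally show "ennreal ((norm (E t *v x))\<^sup>2)
            \<le> ennreal (B\<^sup>2 * (norm (E t))\<^sup>2) * ennreal ((norm x)\<^sup>2)"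
          by (simp add: ennreal_leI flip: ennreal_mult)
      qed
      also have "\<dots> = ennreal (B\<^sup>2 * (norm (E t))\<^sup>2) * (\<integral>\<^sup>+x. ennreal ((norm x)\<^sup>2) \<partial>\<mu> t)"
        by (rule nn_integral_cmult) measurable
      also have "\<dots> \<le> ennreal (B\<^sup>2 * (norm (E t))\<^sup>2) * ennreal K"
        by (intro mult_left_mono K t) auto
      also have "\<dots> = ennreal (B\<^sup>2 * K) * ennreal ((norm (E t))\<^sup>2)"
        using K(1) by (simp add: mult_ac flip: ennreal_mult)
      finally show "(\<integral>\<^sup>+x. ennreal ((norm (E t *v x))\<^sup>2) \<partial>\<mu> t)
          \<le> ennreal (B\<^sup>2 * K) * ennreal ((norm (E t))\<^sup>2)" .
    qed
    also have "\<dots> = ennreal (B\<^sup>2 * K) * (\<integral>\<^sup>+t. ennreal ((norm (E t))\<^sup>2) \<partial>unit_time)"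
      by (rule nn_integral_cmult) measurable
    also have "\<dots> < \<infinity>"
      using int(1) by (simp add: integrable_iff_bounded ennreal_mult_less_top)
    finally show ?thesis .
  qed
  ultimately have 1: "(\<lambda>t x. E t *v x) \<in> L2_path \<mu>"
    by (simp add: L2_path_def)
  have "kinetic_energy \<mu> (\<lambda>t x. C t) \<le> (\<integral>\<^sup>+t. ennreal ((norm (C t))\<^sup>2) \<partial>unit_time)"
    unfolding kinetic_energy_def
  proof (rule nn_integral_mono)
    fix t assume "t \<in> space unit_time"
    then have *: "\<mu> t \<in> P2" using P2_curves_P2[OF \<mu>, of t] by auto
    interpret prob_space "\<mu> t" by (rule P2D[OF *])
    show "(\<integral>\<^sup>+x. ennreal ((norm (C t))\<^sup>2) \<partial>\<mu> t) \<le> ennreal ((norm (C t))\<^sup>2)"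
      by (simp add: emeasure_space_1)
  qed
  also have "\<dots> < \<infinity>" using int(2) by (simp add: integrable_iff_bounded)
  finally have 2: "(\<lambda>t x. C t) \<in> L2_path \<mu>"
    by (simp add: L2_path_def jointly_measurable_def)
  show ?thesis by (rule L2_path_add[OF \<mu> 1 2])
qed

subsection \<open>Test functions and the continuity equation\<close>

lemma test_functions_differentiable:
  "\<phi> \<in> test_functions S \<Longrightarrow> \<phi> differentiable (at x)"
  unfolding test_functions_def smooth_def by (auto dest: spec[of _ "Suc 0"])

lemma test_functions_has_derivative:
  "\<phi> \<in> test_functions S \<Longrightarrow> (\<phi> has_derivative frechet_derivative \<phi> (at x)) (at x)"
  using test_functions_differentiable frechet_derivative_works by blast

lemma test_functions_continuous_derivative:
  assumes "\<phi> \<in> test_functions S"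
  shows "continuous_on UNIV (\<lambda>x. frechet_derivative \<phi> (at x) v)"
proof -
  have "C_k (Suc 0) \<phi>" using assms by (simp add: test_functions_def smooth_def del: C_k.simps)
  then show ?thesis by simp
qed

text \<open>The derivative is continuous on the compact support and vanishes off it, because the
  function is zero on an open neighbourhood of each outside point.\<close>

lemma test_functions_bounded_derivative:
  assumes \<phi>: "\<phi> \<in> test_functions S"
  shows "\<exists>B. \<forall>x. \<bar>frechet_derivative \<phi> (at x) v\<bar> \<le> B"
proof -
  define K where "K = closure {x. \<phi> x \<noteq> 0}"
  have "compact K" using \<phi> by (simp add: test_functions_def K_def)
  then have "compact ((\<lambda>x. frechet_derivative \<phi> (at x) v) ` K)"
    using test_functions_continuous_derivative[OF \<phi>]
    by (intro compact_continuous_image) (auto intro: continuous_on_subset)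
  then obtain B where B: "\<forall>x\<in>K. \<bar>frechet_derivative \<phi> (at x) v\<bar> \<le> B"
    by (auto dest!: compact_imp_bounded simp: bounded_iff)
  have "frechet_derivative \<phi> (at x) v = 0" if "x \<notin> K" for x
  proof -
    have "(\<phi> has_derivative (\<lambda>_. 0)) (at x)"
    proof (rule has_derivative_transform_within_open[OF has_derivative_const])
      show "open (- K)" unfolding K_def by (intro open_Compl closed_closure)
      show "x \<in> - K" using that by simp
      show "0 = \<phi> y" if "y \<in> - K" for y
        using that closure_subset[of "{x. \<phi> x \<noteq> 0}"] by (auto simp: K_def)
    qed
    then show ?thesis by (simp add: frechet_derivative_at[symmetric])
  qed
  \<comment> \<open>If the support is empty, \<open>B\<close> may be negative; hence the maximum
    with 0.\<close>
  then have "\<bar>frechet_derivative \<phi> (at x) v\<bar> \<le> max B 0" for x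
    using B by (cases "x \<in> K") auto
  then show ?thesis by blast
qed

text \<open>Evaluates the definite description in \<open>grad\<close>: the displayed sum is the
  Riesz representative of the derivative, and uniqueness of derivatives makes it the only
  candidate.\<close>

lemma grad_eqI:
  assumes "(f has_derivative f') (at x)"
  shows "grad f x = (\<Sum>b\<in>Basis. f' b *\<^sub>R b)"
proof -
  have lin: "linear f'" using assms by (rule has_derivative_linear)
  have inner: "h \<bullet> (\<Sum>b\<in>Basis. f' b *\<^sub>R b) = f' h" for h
  proof -
    have "f' h = f' (\<Sum>b\<in>Basis. (h \<bullet> b) *\<^sub>R b)" by (simp add: euclidean_representation)
    also have "\<dots> = (\<Sum>b\<in>Basis. (h \<bullet> b) * f' b)"
      by (simp add: linear_sum[OF lin] linear_scale[OF lin])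
    finally show ?thesis by (simp add: inner_sum_right mult.commute)
  qed
  show ?thesis
    unfolding grad_def
  proof (rule the_equality)
    show "GDERIV f x :> (\<Sum>b\<in>Basis. f' b *\<^sub>R b)"
      using assms by (simp add: gderiv_def inner)
    fix D assume "GDERIV f x :> D"
    then have "(\<lambda>h. h \<bullet> D) = f'"
      unfolding gderiv_def using assms by (rule has_derivative_unique)
    then have "h \<bullet> D = h \<bullet> (\<Sum>b\<in>Basis. f' b *\<^sub>R b)" for h
      unfolding inner by (rule fun_cong)
    then show "D = (\<Sum>b\<in>Basis. f' b *\<^sub>R b)"
      using vector_eq_ldot by blast
  qed
qed

section \<open>Freezing one variable of a space-time test function\<close>

lemma Pair_slice_has_derivative:
  assumes "(f has_derivative f') (at (a, y))"
  shows "((\<lambda>y. f (a, y)) has_derivative (\<lambda>v. f' (0, v))) (at y)"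
  using has_derivative_compose[OF has_derivative_Pair[OF has_derivative_const has_derivative_ident] assms] .

text \<open>The slice's derivative along \<open>v\<close> is the slice of the full derivative along
  \<open>(0, v)\<close>. The induction therefore passes to another function, which is why
  \<open>f\<close> is arbitrary.\<close>

lemma C_k_slice:
  "C_k k f \<Longrightarrow> C_k k (\<lambda>y. f (a, y))"
proof (induction k arbitrary: f)
  case 0
  then show ?case
    by (auto intro!: continuous_on_compose2[of UNIV f] continuous_intros)
next
  case (Suc k)
  have der: "((\<lambda>y. f (a, y)) has_derivative (\<lambda>v. frechet_derivative f (at (a, y)) (0, v))) (at y)" for y
    using Suc.prems by (intro Pair_slice_has_derivative) (auto simp flip: frechet_derivative_works)
  have "C_k k (\<lambda>y. frechet_derivative f (at (a, y)) (0, v))" for v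
    by (rule Suc.IH) (use Suc.prems in simp)
  then show ?case
    using der by (auto simp: frechet_derivative_at[OF der, symmetric] differentiable_def)
qed

text \<open>The support of a slice lies in the projection of a compact set. This allows
  distributions at a fixed time to be tested with slices of space-time test functions.\<close>

lemma test_functions_slice:
  assumes "\<phi> \<in> test_functions S"
  shows "(\<lambda>y. \<phi> (a, y)) \<in> test_functions UNIV"
proof -
  let ?K = "closure {x. \<phi> x \<noteq> 0}"
  have comp: "compact ?K" using assms by (simp add: test_functions_def)
  have "{y. \<phi> (a, y) \<noteq> 0} \<subseteq> snd ` ?K"
  proof
    fix y assume "y \<in> {y. \<phi> (a, y) \<noteq> 0}"
    then have "(a, y) \<in> ?K" by (intro closure_subset[THEN subsetD]) simp
    then show "y \<in> snd ` ?K" by (metis imageI snd_conv)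
  qed
  moreover have "compact (snd ` ?K)"
    using comp by (intro compact_continuous_image continuous_intros)
  ultimately have "compact (closure {y. \<phi> (a, y) \<noteq> 0})"
    by (meson bounded_subset compact_closure compact_imp_bounded)
  then show ?thesis
    using assms by (simp add: test_functions_def smooth_def C_k_slice)
qed

text \<open>Expresses the spatial gradient through space-time directional derivatives, which are
  jointly continuous in \<open>(t, x)\<close> and hence measurable; \<open>deriv_slice\<close> does
  the same for the time derivative.\<close>

lemma grad_slice:
  assumes "\<phi> \<in> test_functions S"
  shows "grad (\<lambda>y. \<phi> (t, y)) x = (\<Sum>b\<in>Basis. frechet_derivative \<phi> (at (t, x)) (0, b) *\<^sub>R b)"
  by (intro grad_eqI Pair_slice_has_derivative test_functions_has_derivative[OF assms])

lemma deriv_slice: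
  fixes \<phi> :: "real \<times> 'a::euclidean_space \<Rightarrow> real"
  assumes "\<phi> \<in> test_functions S"
  shows "deriv (\<lambda>s. \<phi> (s, x)) t = frechet_derivative \<phi> (at (t, x)) (1, 0)"
proof -
  let ?D = "frechet_derivative \<phi> (at (t, x))"
  have D: "(\<phi> has_derivative ?D) (at (t, x))"
    by (rule test_functions_has_derivative[OF assms])
  have "(\<lambda>h. ?D (h, 0)) = (*) (?D (1, 0))"
  proof
    fix h
    show "?D (h, 0) = ?D (1, 0) * h"
      using linear_scale[OF has_derivative_linear[OF D], of h "(1, 0)"] by (simp add: mult.commute)
  qed
  moreover have "((\<lambda>s. \<phi> (s, x)) has_derivative (\<lambda>h. ?D (h, 0))) (at t)"
    using has_derivative_compose[OF has_derivative_Pair[OF has_derivative_ident has_derivative_const] D] .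
  ultimately have "((\<lambda>s. \<phi> (s, x)) has_field_derivative ?D (1, 0)) (at t)"
    by (simp only: has_field_derivative_def)
  then show ?thesis by (rule DERIV_imp_deriv)
qed

text \<open>The Bochner integral is a difference of two nonnegative integrals where it converges and
  0 elsewhere. All pieces, including the set of convergence, depend measurably on the
  parameter.\<close>

lemma integral_measurable_kernel:
  fixes f :: "'a \<Rightarrow> 'b \<Rightarrow> real"
  assumes f: "(\<lambda>(x, y). f x y) \<in> borel_measurable (M \<Otimes>\<^sub>M N)"
    and L: "L \<in> measurable M (subprob_algebra N)"
  shows "(\<lambda>x. \<integral>y. f x y \<partial>L x) \<in> borel_measurable M"
proof -
  have f' [measurable]: "(\<lambda>p. f (fst p) (snd p)) \<in> borel_measurable (M \<Otimes>\<^sub>M N)"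
    using f by (simp add: case_prod_beta')
  have "(\<lambda>(x, y). ennreal \<bar>f x y\<bar>) \<in> borel_measurable (M \<Otimes>\<^sub>M N)"
    "(\<lambda>(x, y). ennreal (f x y)) \<in> borel_measurable (M \<Otimes>\<^sub>M N)"
    "(\<lambda>(x, y). ennreal (- f x y)) \<in> borel_measurable (M \<Otimes>\<^sub>M N)"
    unfolding case_prod_beta' by measurable
  note [measurable] = this[THEN nn_integral_measurable_subprob_algebra2, OF L]
  have eq: "(\<integral>y. f x y \<partial>L x) = (if (\<integral>\<^sup>+y. ennreal \<bar>f x y\<bar> \<partial>L x) < \<infinity>
      then enn2real (\<integral>\<^sup>+y. ennreal (f x y) \<partial>L x) - enn2real (\<integral>\<^sup>+y. ennreal (- f x y) \<partial>L x) else 0)"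
    if x: "x \<in> space M" for x
  proof -
    have "sets (L x) = sets N" using sets_kernel[OF L x] .
    moreover have "(\<lambda>y. f (fst (x, y)) (snd (x, y))) \<in> borel_measurable N"
      by (rule measurable_compose[OF measurable_Pair1'[OF x] f'])
    ultimately have "f x \<in> borel_measurable (L x)"
      by (simp add: measurable_cong_sets[OF \<open>sets (L x) = sets N\<close> refl])
    then have "integrable (L x) (f x) \<longleftrightarrow> (\<integral>\<^sup>+y. ennreal \<bar>f x y\<bar> \<partial>L x) < \<infinity>"
      by (simp add: integrable_iff_bounded)
    then show ?thesis
      by (auto simp: real_lebesgue_integral_def not_integrable_integral_eq)
  qed
  show ?thesis
    by (subst measurable_cong[OF eq]) measurable
qed

text \<open>Square integrability implies integrability for a probability measure, and each component
  of the gradient is bounded.\<close>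

lemma integrable_grad_inner:
  assumes \<mu>: "\<mu> \<in> P2" and V: "V \<in> L2 \<mu>" and \<phi>: "\<phi> \<in> test_functions UNIV"
  shows "integrable \<mu> (\<lambda>x. grad \<phi> x \<bullet> V x)"
proof -
  interpret prob_space \<mu> by (rule P2D[OF \<mu>])
  note [measurable_cong] = P2D(2)[OF \<mu>]
  have [measurable]: "V \<in> borel_measurable \<mu>" using V by (simp add: L2_def)
  have int: "integrable \<mu> (\<lambda>x. (norm (V x))\<^sup>2)" using V by (simp add: L2_def)
  have "integrable \<mu> (\<lambda>x. norm (V x))"
    by (rule square_integrable_imp_integrable[OF _ int]) measurable
  then have int_V: "integrable \<mu> V" by (simp add: integrable_norm_iff)
  have "integrable \<mu> (\<lambda>x. frechet_derivative \<phi> (at x) b * (b \<bullet> V x))" for b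
  proof -
    obtain B where B: "\<And>x. \<bar>frechet_derivative \<phi> (at x) b\<bar> \<le> B"
      using test_functions_bounded_derivative[OF \<phi>] by blast
    have [measurable]: "(\<lambda>x. frechet_derivative \<phi> (at x) b) \<in> borel_measurable borel"
      by (intro borel_measurable_continuous_onI test_functions_continuous_derivative[OF \<phi>])
    show ?thesis
    proof (rule Bochner_Integration.integrable_bound)
      show "integrable \<mu> (\<lambda>x. B * (b \<bullet> V x))" using int_V by auto
      show "AE x in \<mu>. norm (frechet_derivative \<phi> (at x) b * (b \<bullet> V x)) \<le> norm (B * (b \<bullet> V x))"
        using order_trans[OF B abs_ge_self] by (auto simp: abs_mult intro!: mult_right_mono)
    qed measurable
  qed
  then show ?thesis
    by (auto simp: grad_eqI[OF test_functions_has_derivative[OF \<phi>]] inner_sum_left)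
qed

lemma continuity_equation_inner_measurable:
  assumes \<mu>: "\<mu> \<in> P2_curves" and V: "jointly_measurable V" and \<phi>: "\<phi> \<in> test_functions S"
  shows "(\<lambda>t. \<integral>x. deriv (\<lambda>s. \<phi> (s, x)) t + grad (\<lambda>y. \<phi> (t, y)) x \<bullet> V t x \<partial>\<mu> t)
    \<in> borel_measurable unit_time"
proof (rule integral_measurable_kernel[OF _ P2_curves_measurable[OF \<mu>]])
  have V': "(\<lambda>p. V (fst p) (snd p)) \<in> borel_measurable (unit_time \<Otimes>\<^sub>M borel)"
    using V by (simp add: jointly_measurable_def case_prod_beta')
  have id: "(\<lambda>p. (fst p, snd p)) \<in> measurable (unit_time \<Otimes>\<^sub>M borel) (borel :: (real \<times> (real^'a)) measure)"
  proof -
    have "fst \<in> measurable (unit_time \<Otimes>\<^sub>M (borel :: (real^'a) measure)) borel"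
      by (rule measurable_compose[OF measurable_fst])
        (auto simp: unit_time_def intro!: measurable_restrict_space1)
    then show ?thesis
      by (intro borel_measurable_Pair) auto
  qed
  have D: "(\<lambda>p. frechet_derivative \<phi> (at (fst p, snd p)) v) \<in> borel_measurable (unit_time \<Otimes>\<^sub>M borel)" for v
    by (rule measurable_compose[OF id borel_measurable_continuous_onI[OF test_functions_continuous_derivative[OF \<phi>]]])
  show "(\<lambda>(t, x). deriv (\<lambda>s. \<phi> (s, x)) t + grad (\<lambda>y. \<phi> (t, y)) x \<bullet> V t x)
      \<in> borel_measurable (unit_time \<Otimes>\<^sub>M borel)"
    unfolding case_prod_beta' deriv_slice[OF \<phi>] grad_slice[OF \<phi>]
    by (intro borel_measurable_add borel_measurable_inner borel_measurable_sum
        borel_measurable_scaleR borel_measurable_const D V')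
qed

text \<open>At a fixed time the velocity is tested only against the gradient of a slice of the test
  function, so almost every time contributes equally for \<open>V\<close> and
  \<open>W\<close>.\<close>

lemma continuity_equation_cong:
  assumes \<mu>: "\<mu> \<in> P2_curves" and V: "V \<in> L2_path \<mu>" and W: "W \<in> L2_path \<mu>"
    and eq: "AE t in unit_time. dist_eq (neg_div (\<mu> t) (W t)) (neg_div (\<mu> t) (V t))"
    and ce: "continuity_equation \<mu> V"
  shows "continuity_equation \<mu> W"
  unfolding continuity_equation_def
proof
  fix \<phi> :: "real \<times> (real^'a) \<Rightarrow> real"
  assume \<phi>: "\<phi> \<in> test_functions ({0<..<1} \<times> UNIV)"
  let ?G = "\<lambda>V t. \<integral>x. deriv (\<lambda>s. \<phi> (s, x)) t + grad (\<lambda>y. \<phi> (t, y)) x \<bullet> V t x \<partial>\<mu> t"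
  have "AE t in unit_time. ?G W t = ?G V t"
    using eq AE_L2_path_slice[OF \<mu> V] AE_L2_path_slice[OF \<mu> W] AE_space
  proof eventually_elim
    case (elim t)
    then have P2: "\<mu> t \<in> P2" using P2_curves_P2[OF \<mu>, of t] by auto
    interpret prob_space "\<mu> t" by (rule P2D[OF P2])
    note [measurable_cong] = P2D(2)[OF P2]
    note sl = test_functions_slice[OF \<phi>, of t]
    obtain B where B: "\<And>z. \<bar>frechet_derivative \<phi> (at z) (1, 0)\<bar> \<le> B"
      using test_functions_bounded_derivative[OF \<phi>] by blast
    have "(\<lambda>x. frechet_derivative \<phi> (at (t, x)) (1, 0)) \<in> borel_measurable borel"
      by (intro borel_measurable_continuous_onI
          continuous_on_compose2[OF test_functions_continuous_derivative[OF \<phi>]] continuous_intros) auto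
    then have [measurable]: "(\<lambda>x. deriv (\<lambda>s. \<phi> (s, x)) t) \<in> borel_measurable borel"
      by (simp add: deriv_slice[OF \<phi>])
    \<comment> \<open>Both summands must be integrable before the slice integral is split: this one
      is bounded, and the gradient term is covered by \<open>integrable_grad_inner\<close>.\<close>
    have int: "integrable (\<mu> t) (\<lambda>x. deriv (\<lambda>s. \<phi> (s, x)) t)"
      by (rule integrable_const_bound[where B=B]) (use B in \<open>auto simp: deriv_slice[OF \<phi>, symmetric]\<close>)
    have "(\<integral>x. grad (\<lambda>y. \<phi> (t, y)) x \<bullet> W t x \<partial>\<mu> t) = (\<integral>x. grad (\<lambda>y. \<phi> (t, y)) x \<bullet> V t x \<partial>\<mu> t)"
      using elim(1) sl by (auto simp: dist_eq_def neg_div_def)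
    then show ?case
      using int integrable_grad_inner[OF P2 elim(2) sl] integrable_grad_inner[OF P2 elim(3) sl]
      by simp
  qed
  \<comment> \<open>Equality almost everywhere yields equal Bochner integrals here because both
    functions of time are measurable.\<close>
  then have "(\<integral>t. ?G W t \<partial>unit_time) = (\<integral>t. ?G V t \<partial>unit_time)"
    using V W by (intro integral_cong_AE continuity_equation_inner_measurable[OF \<mu> _ \<phi>])
      (auto simp: L2_path_def)
  also have "\<dots> = 0" using ce \<phi> by (simp add: continuity_equation_def)
  finally show "(\<integral>t. ?G W t \<partial>unit_time) = 0" .
qed

subsection \<open>Comparison of the two values\<close>

lemma L2_soD: "E \<in> L2_so \<Longrightarrow> E \<in> L2 unit_time"
  by (simp add: L2_so_def)

lemma rigid_slice_in_rigid_fields: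
  assumes "E \<in> L2_so" "t \<in> {0<..<1}" "(\<lambda>x. E t *v x + C t) \<in> L2 (\<mu> t)"
  shows "(\<lambda>x. E t *v x + C t) \<in> rigid_fields (\<mu> t)"
proof -
  have "skew (E t)" using assms by (simp add: L2_so_def)
  then show ?thesis unfolding rigid_fields_def using assms(3) by (intro CollectI conjI exI[of _ "E t"] exI[of _ "C t"]) auto
qed

text \<open>In the infimum defining \<open>mbb_sq\<close>, the full velocity and its rigid part are
  competitors with difference \<open>V t\<close>. The comparison of time integrals is monotonicity,
  valid for lower integrals and so applicable to the seminorm.\<close>

lemma geometric_action_le_kinetic_energy:
  assumes \<mu>: "\<mu> \<in> P2_curves" and V: "V \<in> L2_path \<mu>"
    and E: "E \<in> L2_so" and C: "C \<in> L2 unit_time"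
  shows "geometric_action \<mu> (\<lambda>t x. V t x + E t *v x + C t) \<le> kinetic_energy \<mu> V"
  unfolding geometric_action_def kinetic_energy_def
proof (rule nn_integral_mono_AE)
  let ?R = "\<lambda>t x. E t *v x + C t"
  have R: "?R \<in> L2_path \<mu>" by (rule rigid_path_in_L2_path[OF \<mu> L2_soD[OF E] C])
  show "AE t in unit_time. mbb_sq (\<mu> t) (time_deriv \<mu> (\<lambda>t x. V t x + E t *v x + C t) t)
      \<le> (\<integral>\<^sup>+x. ennreal ((norm (V t x))\<^sup>2) \<partial>\<mu> t)"
    using AE_L2_path_slice[OF \<mu> L2_path_add[OF \<mu> V R]] AE_L2_path_slice[OF \<mu> R] AE_space
  proof eventually_elim
    case (elim t)
    show ?case
      unfolding mbb_sq_def
    proof (intro Inf_lower CollectI exI conjI)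
      show "(\<lambda>x. V t x + ?R t x) \<in> L2 (\<mu> t)" by (rule elim(1))
      show "?R t \<in> rigid_fields (\<mu> t)"
        using elim by (intro rigid_slice_in_rigid_fields[OF E]) auto
      show "dist_eq (neg_div (\<mu> t) (\<lambda>x. V t x + ?R t x))
          (time_deriv \<mu> (\<lambda>t x. V t x + E t *v x + C t) t)"
        by (simp add: dist_eq_def time_deriv_def add.assoc)
    qed simp
  qed
qed

lemma dgeom_sq_le_dbar_sq: "dgeom_sq \<mu>\<^sub>0 \<mu>\<^sub>1 \<le> dbar_sq \<mu>\<^sub>0 \<mu>\<^sub>1"
  unfolding dbar_sq_def
proof (rule Inf_greatest, elim CollectE exE conjE, clarify)
  fix \<mu> :: "real \<Rightarrow> (real^'a) measure" and V E C
  assume \<mu>: "\<mu> \<in> P2_curves" and V: "V \<in> L2_path \<mu>" and E: "E \<in> L2_so" and C: "C \<in> L2 unit_time"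
    and ce: "continuity_equation \<mu> (\<lambda>t x. V t x + E t *v x + C t)"
  have "(\<lambda>t x. V t x + E t *v x + C t) \<in> L2_path \<mu>"
    using L2_path_add[OF \<mu> V rigid_path_in_L2_path[OF \<mu> L2_soD[OF E] C]] by (simp add: add.assoc)
  then have "dgeom_sq (\<mu> 0) (\<mu> 1) \<le> geometric_action \<mu> (\<lambda>t x. V t x + E t *v x + C t)"
    unfolding dgeom_sq_def using \<mu> ce by (auto simp: admissible_def intro!: Inf_lower)
  also have "\<dots> \<le> kinetic_energy \<mu> V"
    by (rule geometric_action_le_kinetic_energy[OF \<mu> V E C])
  finally show "dgeom_sq (\<mu> 0) (\<mu> 1) \<le> kinetic_energy \<mu> V" .
qed

lemma dbar_sq_le_of_selection:
  assumes adm: "admissible \<mu>\<^sub>0 \<mu>\<^sub>1 \<mu> V"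
    and W: "jointly_measurable W" and E: "E \<in> L2_so" and C: "C \<in> L2 unit_time"
    and eq: "AE t in unit_time. dist_eq (neg_div (\<mu> t) (W t)) (time_deriv \<mu> V t)"
    and fin: "kinetic_energy \<mu> (\<lambda>t x. W t x - (E t *v x + C t)) < \<infinity>"
  shows "dbar_sq \<mu>\<^sub>0 \<mu>\<^sub>1 \<le> kinetic_energy \<mu> (\<lambda>t x. W t x - (E t *v x + C t))"
proof -
  let ?R = "\<lambda>t x. E t *v x + C t"
  have \<mu>: "\<mu> \<in> P2_curves" and V: "V \<in> L2_path \<mu>" and ce: "continuity_equation \<mu> V"
    and ends: "\<mu> 0 = \<mu>\<^sub>0" "\<mu> 1 = \<mu>\<^sub>1"
    using adm by (auto simp: admissible_def)
  have R: "?R \<in> L2_path \<mu>" by (rule rigid_path_in_L2_path[OF \<mu> L2_soD[OF E] C])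
  have "(\<lambda>p. (\<lambda>(t, x). W t x) p - (\<lambda>(t, x). ?R t x) p) \<in> borel_measurable (unit_time \<Otimes>\<^sub>M borel)"
    using W R by (intro borel_measurable_diff) (auto simp: jointly_measurable_def L2_path_def)
  then have WR: "(\<lambda>t x. W t x - ?R t x) \<in> L2_path \<mu>"
    using fin by (simp add: L2_path_def jointly_measurable_def case_prod_beta')
  \<comment> \<open>Only \<open>W\<close> minus the rigid field has finite energy by hypothesis;
    adding back the rigid field, itself of finite energy, gives it for \<open>W\<close>.\<close>
  have "W \<in> L2_path \<mu>"
    using L2_path_add[OF \<mu> WR R] by simp
  then have "continuity_equation \<mu> W"
    using continuity_equation_cong[OF \<mu> V _ _ ce] eq by (simp add: time_deriv_def)
  moreover have "(\<lambda>t x. W t x - ?R t x + E t *v x + C t) = W"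
    by (simp add: fun_eq_iff)
  ultimately have "continuity_equation \<mu> (\<lambda>t x. W t x - ?R t x + E t *v x + C t)"
    by simp
  with \<mu> WR E C ends show ?thesis
    unfolding dbar_sq_def
    by (intro Inf_lower CollectI exI[of _ \<mu>] exI[of _ "\<lambda>t x. W t x - ?R t x"]
        exI[of _ E] exI[of _ C]) simp
qed

theorem proposition1:
  fixes \<mu>\<^sub>0 \<mu>\<^sub>1 :: "(real^'n) measure"
  assumes "\<mu>\<^sub>0 \<in> P2" and "\<mu>\<^sub>1 \<in> P2"
  shows "dgeom_sq \<mu>\<^sub>0 \<mu>\<^sub>1 \<le> dbar_sq \<mu>\<^sub>0 \<mu>\<^sub>1 \<and>
    ((\<forall>\<mu> V. admissible \<mu>\<^sub>0 \<mu>\<^sub>1 \<mu> V \<and> geometric_action \<mu> V < \<infinity> \<longrightarrow>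
        (\<forall>\<epsilon>::real. \<epsilon> > 0 \<longrightarrow>
          (\<exists>W E C. jointly_measurable W \<and> E \<in> L2_so \<and> C \<in> L2 unit_time \<and>
             (AE t in unit_time. dist_eq (neg_div (\<mu> t) (W t)) (time_deriv \<mu> V t)) \<and>
             kinetic_energy \<mu> (\<lambda>t x. W t x - (E t *v x + C t))
               \<le> geometric_action \<mu> V + ennreal \<epsilon>)))
      \<longrightarrow> dgeom_sq \<mu>\<^sub>0 \<mu>\<^sub>1 = dbar_sq \<mu>\<^sub>0 \<mu>\<^sub>1)"
proof (intro conjI impI)
  show le: "dgeom_sq \<mu>\<^sub>0 \<mu>\<^sub>1 \<le> dbar_sq \<mu>\<^sub>0 \<mu>\<^sub>1" by (rule dgeom_sq_le_dbar_sq)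
  assume sel: "\<forall>\<mu> V. admissible \<mu>\<^sub>0 \<mu>\<^sub>1 \<mu> V \<and> geometric_action \<mu> V < \<infinity> \<longrightarrow>
        (\<forall>\<epsilon>::real. \<epsilon> > 0 \<longrightarrow>
          (\<exists>W E C. jointly_measurable W \<and> E \<in> L2_so \<and> C \<in> L2 unit_time \<and>
             (AE t in unit_time. dist_eq (neg_div (\<mu> t) (W t)) (time_deriv \<mu> V t)) \<and>
             kinetic_energy \<mu> (\<lambda>t x. W t x - (E t *v x + C t))
               \<le> geometric_action \<mu> V + ennreal \<epsilon>))"
  have "dbar_sq \<mu>\<^sub>0 \<mu>\<^sub>1 \<le> geometric_action \<mu> V" if adm: "admissible \<mu>\<^sub>0 \<mu>\<^sub>1 \<mu> V" for \<mu> V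
  \<comment> \<open>An infinite action bounds everything, so this rule leaves only the finite case,
    in which the selection hypothesis applies.\<close>
  proof (rule ennreal_le_epsilon)
    fix e :: real
    assume "geometric_action \<mu> V < top" and e: "0 < e"
    then have fin: "geometric_action \<mu> V < \<infinity>" by simp
    obtain W E C where W: "jointly_measurable W" and E: "E \<in> L2_so" and C: "C \<in> L2 unit_time"
      and eq: "AE t in unit_time. dist_eq (neg_div (\<mu> t) (W t)) (time_deriv \<mu> V t)"
      and ke: "kinetic_energy \<mu> (\<lambda>t x. W t x - (E t *v x + C t)) \<le> geometric_action \<mu> V + ennreal e"
      using sel[rule_format, OF conjI[OF adm fin] e] by blast
    \<comment> \<open>This also bounds the energy of the selected difference, as
      \<open>dbar_sq_le_of_selection\<close> requires.\<close>
    have "geometric_action \<mu> V + ennreal e < \<infinity>" using fin by simp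
    then show "dbar_sq \<mu>\<^sub>0 \<mu>\<^sub>1 \<le> geometric_action \<mu> V + ennreal e"
      using dbar_sq_le_of_selection[OF adm W E C eq le_less_trans[OF ke]] ke by (meson order_trans)
  qed
  then have "dbar_sq \<mu>\<^sub>0 \<mu>\<^sub>1 \<le> dgeom_sq \<mu>\<^sub>0 \<mu>\<^sub>1"
    unfolding dgeom_sq_def by (auto intro!: Inf_greatest)
  with le show "dgeom_sq \<mu>\<^sub>0 \<mu>\<^sub>1 = dbar_sq \<mu>\<^sub>0 \<mu>\<^sub>1" by (rule antisym)
qed

end
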